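(* Let $I,J\subset\mathbb{R}$ be intervals, let $\gamma(x,t)$, $(x,t)\in I\times J$, be a smooth variation of a transverse curve in $S^3$, and let $(\Gamma,B,V)$ be a natural frame along $\gamma(\cdot,t)$ for each $t\in J$, varying smoothly in $(x,t)$, with invariants $z(x,t)\in\mathbb{C}$ and $m(x,t)\in\mathbb{R}$. Then the geometric flow $$\Gamma_t=\mathrm{i}\left(\Gamma_{xx}-\langle\Gamma_{xx},\Gamma_x\rangle\,\mathrm{i}\,\Gamma\right)$$ can be rewritten as $$\Gamma_t=\mathrm{i}\,z\,B ,$$ and if $\Gamma$ evolves by this flow, then $z$ and $m$ satisfy the Yajima-Oikawa equations $$z_t=\mathrm{i}\,(z_{xx}-m z),\qquad m_t=2\,(|z|^2)_x .$$
   Context: $\mathbb{C}^3$ carries the indefinite Hermitian form $\langle \mathbf z,\mathbf w\rangle=\mathrm{i}(z_3\overline{w_1}-z_1\overline{w_3})+z_2\overline{w_2}$ (linear in the first slot, conjugate-linear in the second). The null cone $\mathcal N\subset\mathbb{C}^3$ is the set of nonzero vectors $\mathbf z$ with $\langle\mathbf z,\mathbf z\rangle=0$; the set of complex lines in $\mathcal N$ is identified with $S^3$, and $\pi:\mathcal N\to S^3$ denotes projectivization. A lift of a curve $\gamma$ in $S^3$ is a smooth curve $\Gamma$ in $\mathcal N$ with $\pi\circ\Gamma=\gamma$. A regular parametrized curve $\gamma(x)$ in $S^3$ is transverse (a T-curve) if it has a lift with $\operatorname{Im}\langle\Gamma_x,\Gamma\rangle\neq 0$ everywhere. A unimodular null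 frame is an ordered triple $(\Gamma,B,V)$ of vectors in $\mathbb{C}^3$ with $\langle\Gamma,\Gamma\rangle=\langle V,V\rangle=\langle B,\Gamma\rangle=\langle B,V\rangle=0$, $\langle\Gamma,V\rangle=-\mathrm{i}$, $\langle V,\Gamma\rangle=\mathrm{i}$, $\langle B,B\rangle=1$ and $\det(\Gamma,B,V)=1$. A natural frame along a transverse curve $\gamma(x)$ is a smooth unimodular null frame field $(\Gamma,B,V)$ along $\gamma$, with $\Gamma$ a lift of $\gamma$, satisfying $$\Gamma_x=V,\qquad B_x=-\mathrm{i}\,\overline{z}\,\Gamma,\qquad V_x=m\,\Gamma+z\,B$$ for some smooth functions $z$ (complex-valued) and $m$ (real-valued), called the invariants. In particular the lift satisfies $\langle\mathrm{i}\Gamma,\Gamma_x\rangle=1$ and $\langle\Gamma_x,\Gamma_x\rangle=0$. Subscripts $x,t$ denote partial derivatives. *)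

theory Defs
  imports "HOL-Analysis.Analysis"
begin

text \<open>
  Smoothness on a set that need not be open (e.g. a product of intervals, possibly containing
  endpoints).  Derivatives are taken within the set; this is meaningful where such derivatives are
  unique, in particular on intervals with nonempty interior and on products of such intervals.
  There it agrees with the usual notion, with one-sided derivatives at the boundary.
\<close>

primrec Ck_on :: "nat \<Rightarrow> 'a::real_normed_vector set \<Rightarrow> ('a \<Rightarrow> 'b::real_normed_vector) \<Rightarrow> bool" where
  "Ck_on 0 S f \<longleftrightarrow> continuous_on S f"
| "Ck_on (Suc k) S f \<longleftrightarrow>
     f differentiable_on S \<and> (\<forall>v. Ck_on k S (\<lambda>p. frechet_derivative f (at p within S) v))"

definition smooth_on :: "'a::real_normed_vector set \<Rightarrow> ('a \<Rightarrow> 'b::real_normed_vector) \<Rightarrow> bool" where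
  "smooth_on S f \<longleftrightarrow> (\<forall>k. Ck_on k S f)"

definition partial_x ::
    "real set \<Rightarrow> (real \<Rightarrow> real \<Rightarrow> 'a::real_normed_vector) \<Rightarrow> real \<Rightarrow> real \<Rightarrow> 'a" where
  "partial_x I f x t = vector_derivative (\<lambda>y. f y t) (at x within I)"

definition herm :: "complex^3 \<Rightarrow> complex^3 \<Rightarrow> complex" where
  "herm z w = \<i> * (z$3 * cnj (w$1) - z$1 * cnj (w$3)) + z$2 * cnj (w$2)"

definition null_cone :: "(complex^3) set" where
  "null_cone = {z. z \<noteq> 0 \<and> herm z z = 0}"

text \<open>
  Points of \<open>S\<^sup>3\<close> are the complex lines spanned by null vectors; a line is represented by the
  set of its elements, \<open>0\<close> included.
\<close>

definition proj :: "complex^3 \<Rightarrow> (complex^3) set" where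
  "proj z = range (\<lambda>c. c *s z)"

definition S3 :: "(complex^3) set set" where
  "S3 = proj ` null_cone"

definition is_lift ::
    "'a::real_normed_vector set \<Rightarrow> ('a \<Rightarrow> (complex^3) set) \<Rightarrow> ('a \<Rightarrow> complex^3) \<Rightarrow> bool" where
  "is_lift S \<gamma> \<Gamma> \<longleftrightarrow> smooth_on S \<Gamma> \<and> (\<forall>p\<in>S. \<Gamma> p \<in> null_cone \<and> proj (\<Gamma> p) = \<gamma> p)"

text \<open>
  As \<open>proj\<close> is a submersion from the null cone onto \<open>S\<^sup>3\<close>, a map into \<open>S\<^sup>3\<close> is smooth iff it
  locally has smooth lifts.
\<close>

definition smooth_to_S3 ::
    "'a::real_normed_vector set \<Rightarrow> ('a \<Rightarrow> (complex^3) set) \<Rightarrow> bool" where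
  "smooth_to_S3 S \<gamma> \<longleftrightarrow> \<gamma> ` S \<subseteq> S3 \<and>
     (\<forall>p\<in>S. \<exists>U \<Gamma>. open U \<and> p \<in> U \<and> is_lift (S \<inter> U) \<gamma> \<Gamma>)"

text \<open>
  The kernel of the differential of \<open>proj\<close> at \<open>\<Gamma>\<close> is the line spanned by \<open>\<Gamma>\<close>, so the velocity of
  \<open>\<gamma> = proj \<circ> \<Gamma>\<close> is nonzero iff the velocity of \<open>\<Gamma>\<close> does not lie on that line.
\<close>

definition regular_curve :: "real set \<Rightarrow> (real \<Rightarrow> (complex^3) set) \<Rightarrow> bool" where
  "regular_curve I \<gamma> \<longleftrightarrow> smooth_to_S3 I \<gamma> \<and>
     (\<exists>\<Gamma>. is_lift I \<gamma> \<Gamma> \<and> (\<forall>x\<in>I. vector_derivative \<Gamma> (at x within I) \<notin> proj (\<Gamma> x)))"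

definition transverse_curve :: "real set \<Rightarrow> (real \<Rightarrow> (complex^3) set) \<Rightarrow> bool" where
  "transverse_curve I \<gamma> \<longleftrightarrow> regular_curve I \<gamma> \<and>
     (\<exists>\<Gamma>. is_lift I \<gamma> \<Gamma> \<and>
          (\<forall>x\<in>I. Im (herm (vector_derivative \<Gamma> (at x within I)) (\<Gamma> x)) \<noteq> 0))"

definition transverse_variation ::
    "real set \<Rightarrow> real set \<Rightarrow> (real \<Rightarrow> real \<Rightarrow> (complex^3) set) \<Rightarrow> bool" where
  "transverse_variation I J \<gamma> \<longleftrightarrow>
     smooth_to_S3 (I \<times> J) (\<lambda>(x, t). \<gamma> x t) \<and> (\<forall>t\<in>J. transverse_curve I (\<lambda>x. \<gamma> x t))"

text \<open>
  In the determinant, \<open>vector [G, B, V]\<close> has the three vectors as rows; the determinant is the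
  same as that of the matrix having them as columns.
\<close>

definition unimodular_null_frame :: "complex^3 \<Rightarrow> complex^3 \<Rightarrow> complex^3 \<Rightarrow> bool" where
  "unimodular_null_frame G B V \<longleftrightarrow>
     herm G G = 0 \<and> herm V V = 0 \<and> herm B G = 0 \<and> herm B V = 0 \<and>
     herm G V = - \<i> \<and> herm V G = \<i> \<and> herm B B = 1 \<and>
     det (vector [G, B, V] :: complex^3^3) = 1"

definition natural_frame ::
    "real set \<Rightarrow> (real \<Rightarrow> (complex^3) set) \<Rightarrow> (real \<Rightarrow> complex^3) \<Rightarrow> (real \<Rightarrow> complex^3) \<Rightarrow>
     (real \<Rightarrow> complex^3) \<Rightarrow> (real \<Rightarrow> complex) \<Rightarrow> (real \<Rightarrow> real) \<Rightarrow> bool" where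
  "natural_frame I \<gamma> \<Gamma> B V z m \<longleftrightarrow>
     is_lift I \<gamma> \<Gamma> \<and> smooth_on I B \<and> smooth_on I V \<and> smooth_on I z \<and> smooth_on I m \<and>
     (\<forall>x\<in>I. unimodular_null_frame (\<Gamma> x) (B x) (V x) \<and>
        (\<Gamma> has_vector_derivative V x) (at x within I) \<and>
        (B has_vector_derivative (- \<i> * cnj (z x)) *s \<Gamma> x) (at x within I) \<and>
        (V has_vector_derivative (of_real (m x) *s \<Gamma> x + z x *s B x)) (at x within I))"

text \<open>The right-hand side of the geometric flow: \<open>\<i> (\<Gamma>\<^sub>x\<^sub>x - \<langle>\<Gamma>\<^sub>x\<^sub>x, \<Gamma>\<^sub>x\<rangle> \<i> \<Gamma>)\<close>.\<close>

definition flow_velocity ::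
    "real set \<Rightarrow> (real \<Rightarrow> real \<Rightarrow> complex^3) \<Rightarrow> real \<Rightarrow> real \<Rightarrow> complex^3" where
  "flow_velocity I \<Gamma> x t =
     (let \<Gamma>x = partial_x I \<Gamma>; \<Gamma>xx = partial_x I \<Gamma>x
      in \<i> *s (\<Gamma>xx x t - herm (\<Gamma>xx x t) (\<Gamma>x x t) *s (\<i> *s \<Gamma> x t)))"

definition geometric_flow ::
    "real set \<Rightarrow> real set \<Rightarrow> (real \<Rightarrow> real \<Rightarrow> complex^3) \<Rightarrow> bool" where
  "geometric_flow I J \<Gamma> \<longleftrightarrow>
     (\<forall>x\<in>I. \<forall>t\<in>J. ((\<lambda>s. \<Gamma> x s) has_vector_derivative flow_velocity I \<Gamma> x t) (at t within J))"

definition yajima_oikawa ::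
    "real set \<Rightarrow> real set \<Rightarrow> (real \<Rightarrow> real \<Rightarrow> complex) \<Rightarrow> (real \<Rightarrow> real \<Rightarrow> real) \<Rightarrow> bool" where
  "yajima_oikawa I J z m \<longleftrightarrow>
     (\<forall>x\<in>I. \<forall>t\<in>J.
        ((\<lambda>s. z x s) has_vector_derivative
           \<i> * (partial_x I (partial_x I z) x t - of_real (m x t) * z x t)) (at t within J) \<and>
        ((\<lambda>s. m x s) has_vector_derivative
           2 * partial_x I (\<lambda>y s. (cmod (z y s))\<^sup>2) x t) (at t within J))"

end

theory Submission
  imports Defs
begin

text \<open>
  Substituting the structure equations into the right-hand side of the flow gives
  \<open>\<i> z B\<close> at once: the multiple of \<open>\<Gamma>\<close> that the flow subtracts cancels \<open>m \<Gamma>\<close> in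
  \<open>\<Gamma>\<^sub>x\<^sub>x = m \<Gamma> + z B\<close>.

  The evolution equations are the zero-curvature condition for the moving frame.  Equality of the
  mixed partials of \<open>\<Gamma>\<close> turns \<open>\<Gamma>\<^sub>t = \<i> z B\<close> into \<open>V\<^sub>t = \<i> z\<^sub>x B + \<bar>z\<bar>\<^sup>2 \<Gamma>\<close>.  The vector
  \<open>B\<^sub>t\<close> is then controlled by the frame conditions: differentiating \<open>\<langle>B, V\<rangle> = 0\<close> gives
  \<open>\<langle>B\<^sub>t, V\<rangle> = \<i> cnj z\<^sub>x\<close>, and differentiating \<open>det (\<Gamma>, B, V) = 1\<close> gives \<open>\<langle>B\<^sub>t, B\<rangle> = 0\<close>.  The
  determinant is indispensable here: the Hermitian relations alone leave the phase of \<open>B\<close>, hence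
  that of \<open>z\<close>, free to vary with \<open>t\<close>.  Finally, equality of the mixed partials of \<open>V\<close>,
  \<open>(m \<Gamma> + z B)\<^sub>t = (\<i> z\<^sub>x B + \<bar>z\<bar>\<^sup>2 \<Gamma>)\<^sub>x\<close>,
  paired with \<open>B\<close> and with \<open>V\<close>, is the Yajima-Oikawa system (\<open>null_frame_zero_curvature\<close>).

  Two analytic points need care.  The intervals may contain endpoints, so the symmetry of mixed
  partials is needed up to the boundary (\<open>mixed_partials_within\<close>).  The invariants are not assumed
  to be differentiable in \<open>t\<close>; this follows from \<open>z = \<langle>V\<^sub>x, B\<rangle>\<close> and \<open>m = \<i> \<langle>V\<^sub>x, V\<rangle>\<close>, as the frame
  is jointly smooth.
\<close>

section \<open>Derivatives within intervals\<close>

lemma interval_at_within_neq_bot: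
  fixes I :: "real set"
  assumes "is_interval I" "interior I \<noteq> {}" "x \<in> I"
  shows "at x within I \<noteq> bot"
proof -
  have "I \<noteq> {a}" for a
    using assms(2) by auto
  then have "x islimpt I"
    using assms is_interval_connected connected_imp_perfect by blast
  then show ?thesis
    by (simp add: trivial_limit_within)
qed

lemma norm_vector_derivative_le:
  fixes f :: "real \<Rightarrow> 'a::real_normed_vector"
  assumes nb: "at t within S \<noteq> bot"
    and D: "(f has_vector_derivative D) (at t within S)"
    and B: "eventually (\<lambda>s. norm (f s - f t) \<le> B * \<bar>s - t\<bar>) (at t within S)"
  shows "norm D \<le> B"
proof -
  define q where "q s = (1 / norm (s - t)) *\<^sub>R (f s - (f t + (s - t) *\<^sub>R D))" for s
  have "(q \<longlongrightarrow> 0) (at t within S)"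
    using D unfolding has_vector_derivative_def has_derivative_within q_def by blast
  then have lim: "((\<lambda>s. norm (q s) + B) \<longlongrightarrow> norm (0::'a) + B) (at t within S)"
    by (intro tendsto_intros)
  have "eventually (\<lambda>s. norm D \<le> norm (q s) + B) (at t within S)"
    using B eventually_at_filter[of "\<lambda>s. s \<noteq> t" t S, simplified]
  proof eventually_elim
    case (elim s)
    then have qs: "norm (f s - (f t + (s - t) *\<^sub>R D)) = \<bar>s - t\<bar> * norm (q s)"
      by (simp add: q_def)
    have "\<bar>s - t\<bar> * norm D = norm ((f s - f t) - (f s - (f t + (s - t) *\<^sub>R D)))"
      using norm_scaleR[of "s - t" D] by simp
    also have "\<dots> \<le> norm (f s - f t) + norm (f s - (f t + (s - t) *\<^sub>R D))"
      by (rule norm_triangle_ineq4)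
    also have "\<dots> \<le> \<bar>s - t\<bar> * (norm (q s) + B)"
      using elim qs by (simp add: algebra_simps)
    finally show ?case
      using elim by simp
  qed
  then show ?thesis
    using tendsto_lowerbound[OF lim _ nb] by simp
qed

lemma convex_vector_derivative_bound:
  fixes f :: "real \<Rightarrow> 'a::real_normed_vector"
  assumes "convex S" "\<And>x. x \<in> S \<Longrightarrow> (f has_vector_derivative f' x) (at x within S)"
    "\<And>x. x \<in> S \<Longrightarrow> norm (f' x) \<le> B" "x \<in> S" "y \<in> S"
  shows "norm (f x - f y) \<le> B * \<bar>x - y\<bar>"
proof -
  have "onorm (\<lambda>h::real. h *\<^sub>R f' u) \<le> B" if "u \<in> S" for u
    using assms(3)[OF that] by (simp add: onorm_scaleR_left[OF bounded_linear_ident] onorm_id)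
  then show ?thesis
    using differentiable_bound[of S f "\<lambda>u h. h *\<^sub>R f' u" B x y] assms
    by (simp add: has_vector_derivative_def)
qed

text \<open>
  The second difference of \<open>F\<close> over the rectangle with opposite corners \<open>(x, t)\<close> and \<open>(y, s)\<close> is
  estimated by the mean value inequality, first in \<open>s\<close> and then in \<open>y\<close>: near \<open>(x, t)\<close> it differs
  from \<open>(y - x) (s - t) V\<^sub>t(x, t)\<close> by at most \<open>e \<bar>y - x\<bar> \<bar>s - t\<bar>\<close>.  Dividing by \<open>s - t\<close> and letting
  \<open>s\<close> tend to \<open>t\<close> leaves the difference quotient of \<open>W = F\<^sub>t\<close>.  Only points of the rectangle are
  involved, so boundary points are no exception, and the differentiability of \<open>W\<close> comes out as a
  conclusion.
\<close>

lemma mixed_partials_within: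
  fixes F :: "real \<Rightarrow> real \<Rightarrow> 'a::real_normed_vector"
  assumes I: "convex I" and J: "convex J" and x: "x \<in> I" and t: "t \<in> J"
    and nb: "at t within J \<noteq> bot"
    and Fx: "\<And>y s. y \<in> I \<Longrightarrow> s \<in> J \<Longrightarrow> ((\<lambda>y. F y s) has_vector_derivative V y s) (at y within I)"
    and Ft: "\<And>y. y \<in> I \<Longrightarrow> ((\<lambda>s. F y s) has_vector_derivative W y) (at t within J)"
    and Vt: "\<And>y s. y \<in> I \<Longrightarrow> s \<in> J \<Longrightarrow> ((\<lambda>s. V y s) has_vector_derivative Vt y s) (at s within J)"
    and cont: "continuous_on (I \<times> J) (\<lambda>(y, s). Vt y s)"
  shows "(W has_vector_derivative Vt x t) (at x within I)"
  unfolding has_vector_derivative_def has_derivative_within_alt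
proof (intro conjI allI impI)
  show "bounded_linear (\<lambda>h. h *\<^sub>R Vt x t)"
    by (rule bounded_linear_scaleR_left)
  fix e :: real assume e: "0 < e"
  define c where "c = Vt x t"
  obtain d where d: "d > 0"
    and near: "\<And>p. p \<in> I \<times> J \<Longrightarrow> dist p (x, t) < d \<Longrightarrow> dist (case p of (y, s) \<Rightarrow> Vt y s) c < e"
    using cont x t e unfolding continuous_on_iff c_def by force
  have close: "norm (Vt y s - c) \<le> e"
    if "y \<in> I" "s \<in> J" "\<bar>y - x\<bar> < d/2" "\<bar>s - t\<bar> < d/2" for y s
  proof -
    have "dist (y, s) (x, t) \<le> dist y x + dist s t"
      by (simp add: dist_Pair_Pair sqrt_sum_squares_le_sum)
    then show ?thesis
      using near[of "(y, s)"] that by (auto simp: dist_norm)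
  qed
  have "norm (W y - W x - (y - x) *\<^sub>R c) \<le> e * norm (y - x)"
    if y: "y \<in> I" and yd: "norm (y - x) < d/2" for y
  proof (rule norm_vector_derivative_le[OF nb])
    let ?k = "\<lambda>s. F y s - F x s - s *\<^sub>R ((y - x) *\<^sub>R c)"
    show "(?k has_vector_derivative W y - W x - (y - x) *\<^sub>R c) (at t within J)"
      by (auto intro!: derivative_eq_intros Ft x y)
    let ?I = "I \<inter> ball x (d/2)" and ?J = "J \<inter> ball t (d/2)"
    have "eventually (\<lambda>s. s \<in> ?J) (at t within J)"
      using d eventually_at_ball[of "d/2" t J] by (auto elim: eventually_mono)
    then show "eventually (\<lambda>s. norm (?k s - ?k t) \<le> e * norm (y - x) * \<bar>s - t\<bar>) (at t within J)"
    proof eventually_elim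
      case (elim s)
      have V: "norm (V u s - V u t - (s - t) *\<^sub>R c) \<le> e * \<bar>s - t\<bar>" if u: "u \<in> ?I" for u
      proof -
        have "norm ((V u s - s *\<^sub>R c) - (V u t - t *\<^sub>R c)) \<le> e * \<bar>s - t\<bar>"
        proof (rule convex_vector_derivative_bound[where S = ?J])
          fix r assume r: "r \<in> ?J"
          then have "((\<lambda>r. V u r) has_vector_derivative Vt u r) (at r within ?J)"
            using Vt[of u r] u by (auto intro: has_vector_derivative_within_subset)
          then show "((\<lambda>r. V u r - r *\<^sub>R c) has_vector_derivative Vt u r - c) (at r within ?J)"
            by (auto intro!: derivative_eq_intros)
          show "norm (Vt u r - c) \<le> e"
            using close[of u r] u r by (auto simp: dist_real_def abs_minus_commute)
        qed (use J elim t d in \<open>auto intro: convex_Int\<close>)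
        then show ?thesis
          by (simp add: algebra_simps)
      qed
      have "norm ((F y s - F y t - y *\<^sub>R ((s - t) *\<^sub>R c)) - (F x s - F x t - x *\<^sub>R ((s - t) *\<^sub>R c)))
          \<le> (e * \<bar>s - t\<bar>) * \<bar>y - x\<bar>"
      proof (rule convex_vector_derivative_bound[where S = ?I])
        fix u assume u: "u \<in> ?I"
        have "((\<lambda>u. F u r) has_vector_derivative V u r) (at u within ?I)" if "r \<in> J" for r
          using Fx[of u r] u that by (auto intro: has_vector_derivative_within_subset)
        then show "((\<lambda>u. F u s - F u t - u *\<^sub>R ((s - t) *\<^sub>R c))
            has_vector_derivative V u s - V u t - (s - t) *\<^sub>R c) (at u within ?I)"
          using elim t by (auto intro!: derivative_eq_intros)
      qed (use I x y yd d V in \<open>auto intro: convex_Int simp: dist_real_def abs_minus_commute\<close>)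
      then show ?case
        by (simp add: algebra_simps)
    qed
  qed
  then show "\<exists>d>0. \<forall>y\<in>I. norm (y - x) < d \<longrightarrow>
      norm (W y - W x - (y - x) *\<^sub>R Vt x t) \<le> e * norm (y - x)"
    using d by (intro exI[of _ "d/2"]) (auto simp: c_def)
qed

lemma partial_x_eqI:
  assumes "at x within I \<noteq> bot" "((\<lambda>y. f y t) has_vector_derivative D) (at x within I)"
  shows "partial_x I f x t = D"
  unfolding partial_x_def by (rule vector_derivative_within[OF assms])

lemma smooth_on_continuous: "smooth_on S f \<Longrightarrow> continuous_on S f"
  unfolding smooth_on_def by (metis Ck_on.simps(1))

lemma smooth_on_directional:
  assumes "smooth_on S f"
  shows "smooth_on S (\<lambda>p. frechet_derivative f (at p within S) v)"
    and "p \<in> S \<Longrightarrow> (f has_derivative frechet_derivative f (at p within S)) (at p within S)"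
proof -
  have *: "Ck_on (Suc k) S f" for k
    using assms by (simp only: smooth_on_def)
  then show "smooth_on S (\<lambda>p. frechet_derivative f (at p within S) v)"
    by (auto simp: smooth_on_def)
  show "p \<in> S \<Longrightarrow> (f has_derivative frechet_derivative f (at p within S)) (at p within S)"
    using *[of 0] by (simp add: differentiable_on_def flip: frechet_derivative_works)
qed

lemma smooth_on_vector_derivative:
  assumes "smooth_on I f"
  obtains f' where "smooth_on I f'"
    and "\<forall>x\<in>I. (f has_vector_derivative f' x) (at x within I)"
proof (rule that[of "\<lambda>x. frechet_derivative f (at x within I) 1"], rule_tac [2] ballI)
  fix x assume "x \<in> I"
  then have d: "(f has_derivative frechet_derivative f (at x within I)) (at x within I)"
    by (rule smooth_on_directional[OF assms])
  have "frechet_derivative f (at x within I) = (\<lambda>h. h *\<^sub>R frechet_derivative f (at x within I) 1)"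
    (is "?D = ?E")
  proof
    show "?D h = ?E h" for h
      using linear_scale[OF has_derivative_linear[OF d], of h 1] by simp
  qed
  with d have "(f has_derivative ?E) (at x within I)"
    by (rule back_subst[of "\<lambda>D. (f has_derivative D) (at x within I)"])
  then show "(f has_vector_derivative ?D 1) (at x within I)"
    by (simp only: has_vector_derivative_def)
qed (rule smooth_on_directional[OF assms])

text \<open>
  The partial derivatives are taken to be directional Frechet derivatives, as this is the form in
  which smoothness passes to them.
\<close>

lemma smooth_on_partials:
  assumes "smooth_on (I \<times> J) (\<lambda>(x, t). f x t)"
  obtains fx ft where "smooth_on (I \<times> J) (\<lambda>(x, t). fx x t)" "smooth_on (I \<times> J) (\<lambda>(x, t). ft x t)"
    and "\<forall>x\<in>I. \<forall>t\<in>J. ((\<lambda>y. f y t) has_vector_derivative fx x t) (at x within I)"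
    and "\<forall>x\<in>I. \<forall>t\<in>J. ((\<lambda>s. f x s) has_vector_derivative ft x t) (at t within J)"
proof -
  let ?f = "\<lambda>(x, t). f x t"
  define D where "D v x t = frechet_derivative ?f (at (x, t) within I \<times> J) v" for v x t
  have "(\<lambda>(x, t). D v x t) = (\<lambda>p. frechet_derivative ?f (at p within I \<times> J) v)" for v
    by (auto simp: D_def)
  then have sm: "smooth_on (I \<times> J) (\<lambda>(x, t). D v x t)" for v
    using smooth_on_directional(1)[OF assms] by simp
  have d: "(?f has_derivative (\<lambda>v. D v x t)) (at (x, t) within T)"
    if "x \<in> I" "t \<in> J" "T \<subseteq> I \<times> J" for x t T
    using smooth_on_directional(2)[OF assms, of "(x, t)"] that
    unfolding D_def by (auto intro: has_derivative_subset)
  show ?thesis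
  proof (rule that[of "D (1, 0)" "D (0, 1)"], rule_tac [3-4] ballI, rule_tac [3-4] ballI)
    fix x t assume xt: "x \<in> I" "t \<in> J"
    have "((\<lambda>y. (y, t)) has_vector_derivative (1, 0)) (at x within I)"
      by (auto intro!: derivative_eq_intros has_vector_derivative_Pair)
    from vector_derivative_diff_chain_within[OF this d] xt
    show "((\<lambda>y. f y t) has_vector_derivative D (1, 0) x t) (at x within I)"
      by (auto simp: o_def)
    have "((\<lambda>s. (x, s)) has_vector_derivative (0, 1)) (at t within J)"
      by (auto intro!: derivative_eq_intros has_vector_derivative_Pair)
    from vector_derivative_diff_chain_within[OF this d] xt
    show "((\<lambda>s. f x s) has_vector_derivative D (0, 1) x t) (at t within J)"
      by (auto simp: o_def)
  qed (rule sm)+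
qed

section \<open>Algebra of unimodular null frames\<close>

lemma herm_simps:
  "herm (a + b) w = herm a w + herm b w" "herm w (a + b) = herm w a + herm w b"
  "herm (c *s a) w = c * herm a w" "herm w (c *s a) = cnj c * herm w a"
  "herm (a - b) w = herm a w - herm b w"
  by (simp_all add: herm_def algebra_simps)

lemma herm_cnj: "herm w v = cnj (herm v w)"
  by (simp add: herm_def algebra_simps)

lemma bounded_bilinear_herm: "bounded_bilinear herm"
  unfolding bilinear_conv_bounded_bilinear[symmetric] bilinear_def
  by (intro conjI allI linearI) (simp_all add: herm_def algebra_simps)

lemma bounded_bilinear_smult: "bounded_bilinear (\<lambda>c (v::complex^3). c *s v)"
  unfolding bilinear_conv_bounded_bilinear[symmetric] bilinear_def
  by (intro conjI allI linearI) (simp_all add: vec_eq_iff algebra_simps)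

lemmas has_vector_derivative_herm = bounded_bilinear.has_vector_derivative[OF bounded_bilinear_herm]
lemmas has_vector_derivative_smult = bounded_bilinear.has_vector_derivative[OF bounded_bilinear_smult]

lemma has_vector_derivative_det3:
  fixes G B V :: "real \<Rightarrow> complex^3"
  assumes "(G has_vector_derivative G') (at t within S)"
    "(B has_vector_derivative B') (at t within S)"
    "(V has_vector_derivative V') (at t within S)"
  shows "((\<lambda>t. det (vector [G t, B t, V t] :: complex^3^3)) has_vector_derivative
     det (vector [G', B t, V t] :: complex^3^3) + det (vector [G t, B', V t] :: complex^3^3)
       + det (vector [G t, B t, V'] :: complex^3^3)) (at t within S)"
proof -
  have nth: "((\<lambda>t. f t $ i) has_vector_derivative f' $ i) (at t within S)"
    if "(f has_vector_derivative f') (at t within S)" for f :: "real \<Rightarrow> complex^3" and f' i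
    by (rule bounded_linear.has_vector_derivative[OF bounded_linear_vec_nth that])
  show ?thesis
    unfolding det_3 vector_3
    by (auto intro!: derivative_eq_intros nth assms simp: algebra_simps)
qed

text \<open>
  The difference of the two sides is orthogonal to all three frame vectors.  These are linearly
  independent, as their determinant is 1, and the form is nondegenerate.
\<close>

lemma null_frame_expansion:
  assumes "unimodular_null_frame G B V"
  shows "w = (\<i> * herm w V) *s G + herm w B *s B - (\<i> * herm w G) *s V"
proof -
  define u where "u = w - ((\<i> * herm w V) *s G + herm w B *s B - (\<i> * herm w G) *s V)"
  \<comment> \<open>\<open>u'\<close> represents the functional \<open>herm _ u\<close> with respect to the bilinear dot product.\<close>
  define u' :: "complex^3" where "u' = vector [- \<i> * cnj (u$3), cnj (u$2), \<i> * cnj (u$1)]"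
  have fr: "herm G G = 0" "herm V V = 0" "herm B G = 0" "herm B V = 0" "herm G B = 0" "herm V B = 0"
    "herm G V = - \<i>" "herm V G = \<i>" "herm B B = 1"
    using assms herm_cnj[of G B] herm_cnj[of V B] by (auto simp: unimodular_null_frame_def)
  have ii: "\<i> * h * \<i> = - h" for h :: complex
    by (simp add: complex_eq_iff)
  have "herm u G = 0" "herm u B = 0" "herm u V = 0"
    by (simp_all add: u_def herm_simps fr ii)
  then have "herm G u = 0" "herm B u = 0" "herm V u = 0"
    using herm_cnj[of _ u] by auto
  then have "(vector [G, B, V] :: complex^3^3) *v u' = 0"
    by (simp add: vec_eq_iff forall_3 matrix_vector_mult_def sum_3 herm_def u'_def algebra_simps)
  moreover have "invertible (vector [G, B, V] :: complex^3^3)"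
    using assms by (simp add: invertible_det_nz unimodular_null_frame_def)
  ultimately have "u' = 0"
    using matrix_left_invertible_ker[of "vector [G, B, V] :: complex^3^3"]
    by (auto simp: invertible_def)
  then have "u = 0"
    by (simp add: vec_eq_iff forall_3 u'_def)
  then show ?thesis
    by (simp add: u_def)
qed

text \<open>
  This converts the infinitesimal form of the determinant condition into orthogonality to \<open>B\<close>.
\<close>

lemma null_frame_det:
  assumes "unimodular_null_frame G B V"
  shows "det (vector [G, w, V] :: complex^3^3) = herm w B"
proof -
  have "det (vector [G, a *s G + c *s B - b *s V, V] :: complex^3^3)
      = c * det (vector [G, B, V] :: complex^3^3)" for a b c
    by (simp add: det_3 algebra_simps)
  then show ?thesis
    using null_frame_expansion[OF assms, of w] assms by (metis mult.right_neutral unimodular_null_frame_def)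
qed


text \<open>
  The hypothesis \<open>eq\<close> is \<open>V\<^sub>x\<^sub>t = V\<^sub>t\<^sub>x\<close> with both sides expanded by the product rule, \<open>n\<close>
  standing for \<open>(\<bar>z\<bar>\<^sup>2)\<^sub>x\<close>.  Pairing it with \<open>B\<close> isolates \<open>z\<^sub>t\<close>; pairing it with \<open>V\<close>
  isolates \<open>m\<^sub>t\<close>, because \<open>V\<close> is orthogonal to \<open>B\<close> and to itself.
\<close>

lemma null_frame_zero_curvature:
  fixes m z zx zxx zt mt n :: complex
  assumes fr: "unimodular_null_frame G B V"
    and Bt: "herm Bt B = 0" "herm Bt V = \<i> * cnj zx"
    and eq: "mt *s G + m *s ((\<i> * z) *s B) + (zt *s B + z *s Bt)
      = (\<i> * zxx) *s B + (\<i> * zx) *s ((- \<i> * cnj z) *s G) + (n *s G + (z * cnj z) *s V)"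
  shows "zt = \<i> * (zxx - m * z)" "mt = zx * cnj z + z * cnj zx + n"
proof -
  have f: "herm G V = - \<i>" "herm V V = 0" "herm B V = 0" "herm G B = 0" "herm V B = 0" "herm B B = 1"
    using fr herm_cnj[of G B] herm_cnj[of V B] by (auto simp: unimodular_null_frame_def)
  from arg_cong[OF eq, of "\<lambda>w. herm w B"]
  show "zt = \<i> * (zxx - m * z)"
    by (simp add: herm_simps f Bt algebra_simps)
  from arg_cong[OF eq, of "\<lambda>w. \<i> * herm w V"]
  show "mt = zx * cnj z + z * cnj zx + n"
    by (simp add: herm_simps f Bt algebra_simps)
qed

section \<open>Evolution of the invariants\<close>

theorem mainTheorem1:
  fixes I J :: "real set"
    and \<gamma> :: "real \<Rightarrow> real \<Rightarrow> (complex^3) set"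
    and \<Gamma> B V :: "real \<Rightarrow> real \<Rightarrow> complex^3"
    and z :: "real \<Rightarrow> real \<Rightarrow> complex"
    and m :: "real \<Rightarrow> real \<Rightarrow> real"
  assumes "is_interval I" "interior I \<noteq> {}"
    and "is_interval J" "interior J \<noteq> {}"
    and "transverse_variation I J \<gamma>"
    and "\<And>t. t \<in> J \<Longrightarrow>
           natural_frame I (\<lambda>x. \<gamma> x t) (\<lambda>x. \<Gamma> x t) (\<lambda>x. B x t) (\<lambda>x. V x t) (\<lambda>x. z x t) (\<lambda>x. m x t)"
    and "smooth_on (I \<times> J) (\<lambda>(x, t). \<Gamma> x t)"
    and "smooth_on (I \<times> J) (\<lambda>(x, t). B x t)"
    and "smooth_on (I \<times> J) (\<lambda>(x, t). V x t)"
  shows "(\<forall>x\<in>I. \<forall>t\<in>J. flow_velocity I \<Gamma> x t = (\<i> * z x t) *s B x t) \<and>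
         (geometric_flow I J \<Gamma> \<longleftrightarrow>
            (\<forall>x\<in>I. \<forall>t\<in>J.
               ((\<lambda>s. \<Gamma> x s) has_vector_derivative (\<i> * z x t) *s B x t) (at t within J))) \<and>
         (geometric_flow I J \<Gamma> \<longrightarrow> yajima_oikawa I J z m)"
proof -
  have nbI: "at x within I \<noteq> bot" if "x \<in> I" for x
    using interval_at_within_neq_bot assms(1,2) that .
  have nbJ: "at t within J \<noteq> bot" if "t \<in> J" for t
    using interval_at_within_neq_bot assms(3,4) that .
  have cv: "convex I" "convex J"
    using assms(1,3) by (simp_all add: is_interval_convex)
  have fr: "unimodular_null_frame (\<Gamma> x t) (B x t) (V x t)"
    and Gx: "((\<lambda>y. \<Gamma> y t) has_vector_derivative V x t) (at x within I)"
    and Bx: "((\<lambda>y. B y t) has_vector_derivative (- \<i> * cnj (z x t)) *s \<Gamma> x t) (at x within I)"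
    and Vx: "((\<lambda>y. V y t) has_vector_derivative
      (of_real (m x t) *s \<Gamma> x t + z x t *s B x t)) (at x within I)"
    if "x \<in> I" "t \<in> J" for x t
    using assms(6)[OF that(2)] that(1) by (simp_all add: natural_frame_def)
  note px = partial_x_eqI[OF nbI]
  have inner: "herm (\<Gamma> x t) (V x t) = - \<i>" "herm (V x t) (V x t) = 0" "herm (B x t) (V x t) = 0"
    "herm (\<Gamma> x t) (B x t) = 0" "herm (V x t) (B x t) = 0" "herm (B x t) (B x t) = 1"
    if "x \<in> I" "t \<in> J" for x t
    using fr[OF that] herm_cnj[of "\<Gamma> x t" "B x t"] herm_cnj[of "V x t" "B x t"]
    by (auto simp: unimodular_null_frame_def)

  have vel: "flow_velocity I \<Gamma> x t = (\<i> * z x t) *s B x t" if xt: "x \<in> I" "t \<in> J" for x t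
  proof -
    have Gxx: "((\<lambda>y. partial_x I \<Gamma> y t) has_vector_derivative
      (of_real (m x t) *s \<Gamma> x t + z x t *s B x t)) (at x within I)"
      using xt by (intro has_vector_derivative_transform[OF _ _ Vx] px[where f = \<Gamma>] Gx)
    have "flow_velocity I \<Gamma> x t = \<i> *s ((of_real (m x t) *s \<Gamma> x t + z x t *s B x t)
        - herm (of_real (m x t) *s \<Gamma> x t + z x t *s B x t) (V x t) *s (\<i> *s \<Gamma> x t))"
      unfolding flow_velocity_def Let_def px[where f = "partial_x I \<Gamma>" and t = t, OF xt(1) Gxx]
        px[where f = \<Gamma> and t = t, OF xt(1) Gx[OF xt]] ..
    also have "\<dots> = (\<i> * z x t) *s B x t"
      by (simp add: herm_simps inner[OF xt] vec_eq_iff algebra_simps)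
    finally show ?thesis .
  qed
  then have flow: "geometric_flow I J \<Gamma> \<longleftrightarrow> (\<forall>x\<in>I. \<forall>t\<in>J.
      ((\<lambda>s. \<Gamma> x s) has_vector_derivative (\<i> * z x t) *s B x t) (at t within J))"
    by (simp add: geometric_flow_def)

  have yo: "yajima_oikawa I J z m" if gf: "geometric_flow I J \<Gamma>"
  proof -
    have Gt: "((\<lambda>s. \<Gamma> x s) has_vector_derivative (\<i> * z x t) *s B x t) (at t within J)"
      if "x \<in> I" "t \<in> J" for x t
      using gf flow that by blast
    obtain Vx' Vt where Vx'_smooth: "smooth_on (I \<times> J) (\<lambda>(x, t). Vx' x t)"
      and Vt_smooth: "smooth_on (I \<times> J) (\<lambda>(x, t). Vt x t)"
      and Vx': "\<And>x t. x \<in> I \<Longrightarrow> t \<in> J \<Longrightarrow> ((\<lambda>y. V y t) has_vector_derivative Vx' x t) (at x within I)"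
      and Vt: "\<And>x t. x \<in> I \<Longrightarrow> t \<in> J \<Longrightarrow> ((\<lambda>s. V x s) has_vector_derivative Vt x t) (at t within J)"
      using smooth_on_partials[OF assms(9)] by metis
    obtain Bt where
      Bt: "\<And>x t. x \<in> I \<Longrightarrow> t \<in> J \<Longrightarrow> ((\<lambda>s. B x s) has_vector_derivative Bt x t) (at t within J)"
      using smooth_on_partials[OF assms(8)] by metis
    obtain Vxt where Vxt_smooth: "smooth_on (I \<times> J) (\<lambda>(x, t). Vxt x t)"
      and Vxt: "\<And>x t. x \<in> I \<Longrightarrow> t \<in> J \<Longrightarrow> ((\<lambda>s. Vx' x s) has_vector_derivative Vxt x t) (at t within J)"
      using smooth_on_partials[OF Vx'_smooth] by metis
    have Vx'_eq: "Vx' x t = of_real (m x t) *s \<Gamma> x t + z x t *s B x t" if "x \<in> I" "t \<in> J" for x t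
      using vector_derivative_unique_within[OF nbI Vx' Vx] that by blast

    \<comment> \<open>These formulas give the invariants their derivatives in \<open>t\<close>.\<close>
    have z_eq: "z x t = herm (Vx' x t) (B x t)"
      and m_eq: "complex_of_real (m x t) = \<i> * herm (Vx' x t) (V x t)" if "x \<in> I" "t \<in> J" for x t
      using that by (simp_all add: Vx'_eq herm_simps inner algebra_simps)
    have "\<exists>D. ((\<lambda>s. z x s) has_vector_derivative D) (at t within J)" if "x \<in> I" "t \<in> J" for x t
      using has_vector_derivative_transform[OF that(2) z_eq[OF that(1)]
          has_vector_derivative_herm[OF Vxt[OF that] Bt[OF that]]] by blast
    then obtain zt where
      zt: "\<And>x t. x \<in> I \<Longrightarrow> t \<in> J \<Longrightarrow> ((\<lambda>s. z x s) has_vector_derivative zt x t) (at t within J)"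
      by metis
    \<comment> \<open>\<open>m\<close> is treated as a complex function until the last step, so that it can scale vectors.\<close>
    have "\<exists>D. ((\<lambda>s. complex_of_real (m x s)) has_vector_derivative D) (at t within J)"
      if "x \<in> I" "t \<in> J" for x t
      using has_vector_derivative_transform[OF that(2) m_eq[OF that(1)]
          has_vector_derivative_mult_right[OF has_vector_derivative_herm[OF Vxt[OF that] Vt[OF that]]]]
      by blast
    then obtain mt where mt: "\<And>x t. x \<in> I \<Longrightarrow> t \<in> J \<Longrightarrow>
        ((\<lambda>s. complex_of_real (m x s)) has_vector_derivative mt x t) (at t within J)"
      by metis

    have z_smooth: "smooth_on I (\<lambda>x. z x t)" if "t \<in> J" for t
      using assms(6)[OF that] by (simp add: natural_frame_def)
    have "\<exists>zx zxx. \<forall>x\<in>I. ((\<lambda>y. z y t) has_vector_derivative zx x) (at x within I) \<and>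
        (zx has_vector_derivative zxx x) (at x within I)" if "t \<in> J" for t
      by (metis smooth_on_vector_derivative z_smooth[OF that])
    then obtain zx' zxx' where *: "\<And>x t. x \<in> I \<Longrightarrow> t \<in> J \<Longrightarrow>
        ((\<lambda>y. z y t) has_vector_derivative zx' t x) (at x within I) \<and>
        (zx' t has_vector_derivative zxx' t x) (at x within I)"
      by metis
    define zx zxx where "zx x t = zx' t x" and "zxx x t = zxx' t x" for x t
    have zx: "((\<lambda>y. z y t) has_vector_derivative zx x t) (at x within I)"
      and zxx: "((\<lambda>y. zx y t) has_vector_derivative zxx x t) (at x within I)"
      if "x \<in> I" "t \<in> J" for x t
      using *[OF that] by (simp_all add: zx_def zxx_def)
    \<comment> \<open>\<open>N\<close> is \<open>(\<bar>z\<bar>\<^sup>2)\<^sub>x\<close>.\<close>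
    define N where "N x t = z x t * cnj (zx x t) + zx x t * cnj (z x t)" for x t
    have cz: "((\<lambda>y. z y t * cnj (z y t)) has_vector_derivative N x t) (at x within I)"
      if "x \<in> I" "t \<in> J" for x t
      unfolding N_def by (intro derivative_intros zx that)

    have Vt_eq: "Vt x t = (\<i> * zx x t) *s B x t + (z x t * cnj (z x t)) *s \<Gamma> x t"
      if xt: "x \<in> I" "t \<in> J" for x t
    proof -
      have "((\<lambda>y. (\<i> * z y t) *s B y t) has_vector_derivative Vt x t) (at x within I)"
        by (rule mixed_partials_within[OF cv xt nbJ[OF xt(2)] Gx Gt Vt])
          (use xt smooth_on_continuous[OF Vt_smooth] in auto)
      moreover have "((\<lambda>y. (\<i> * z y t) *s B y t) has_vector_derivative
          (\<i> * z x t) *s ((- \<i> * cnj (z x t)) *s \<Gamma> x t) + (\<i> * zx x t) *s B x t) (at x within I)"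
        by (intro has_vector_derivative_smult has_vector_derivative_mult_right zx Bx xt)
      ultimately have "Vt x t =
          (\<i> * z x t) *s ((- \<i> * cnj (z x t)) *s \<Gamma> x t) + (\<i> * zx x t) *s B x t"
        by (rule vector_derivative_unique_within[OF nbI[OF xt(1)]])
      then show ?thesis
        by (simp add: vec_eq_iff algebra_simps)
    qed

    have Bt_B: "herm (Bt x t) (B x t) = 0" if xt: "x \<in> I" "t \<in> J" for x t
    proof -
      have "((\<lambda>s. det (vector [\<Gamma> x s, B x s, V x s] :: complex^3^3)) has_vector_derivative 0) (at t within J)"
        by (rule has_vector_derivative_transform[OF xt(2) _ has_vector_derivative_const[of 1]])
          (use fr xt(1) in \<open>auto simp: unimodular_null_frame_def\<close>)
      \<comment> \<open>The terms with \<open>\<Gamma>\<^sub>t\<close> and \<open>V\<^sub>t\<close> vanish: \<open>\<Gamma>\<^sub>t\<close> is a multiple of \<open>B\<close>, and \<open>V\<^sub>t\<close> lies in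
        the span of \<open>\<Gamma>\<close> and \<open>B\<close>.\<close>
      from vector_derivative_unique_within[OF nbJ[OF xt(2)] this
          has_vector_derivative_det3[OF Gt[OF xt] Bt[OF xt] Vt[OF xt]]]
      have "det (vector [\<Gamma> x t, Bt x t, V x t] :: complex^3^3) = 0"
        by (simp add: Vt_eq[OF xt] det_3 algebra_simps)
      then show ?thesis
        by (simp add: null_frame_det[OF fr[OF xt]])
    qed
    have Bt_V: "herm (Bt x t) (V x t) = \<i> * cnj (zx x t)" if xt: "x \<in> I" "t \<in> J" for x t
    proof -
      have "((\<lambda>s. herm (B x s) (V x s)) has_vector_derivative 0) (at t within J)"
        by (rule has_vector_derivative_transform[OF xt(2) _ has_vector_derivative_const[of 0]])
          (simp add: inner xt(1))
      from vector_derivative_unique_within[OF nbJ[OF xt(2)] this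
          has_vector_derivative_herm[OF Bt[OF xt] Vt[OF xt]]]
      have "herm (B x t) (Vt x t) + herm (Bt x t) (V x t) = 0"
        by simp
      moreover have "herm (B x t) (\<Gamma> x t) = 0"
        using fr[OF xt] by (simp add: unimodular_null_frame_def)
      ultimately show ?thesis
        by (simp add: Vt_eq[OF xt] herm_simps inner[OF xt] algebra_simps)
    qed

    have evol: "zt x t = \<i> * (zxx x t - of_real (m x t) * z x t)"
      "mt x t = zx x t * cnj (z x t) + z x t * cnj (zx x t) + N x t"
      if xt: "x \<in> I" "t \<in> J" for x t
    proof -
      have "((\<lambda>s. Vx' x s) has_vector_derivative
          (of_real (m x t) *s ((\<i> * z x t) *s B x t) + mt x t *s \<Gamma> x t)
            + (z x t *s Bt x t + zt x t *s B x t)) (at t within J)"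
        by (rule has_vector_derivative_transform[OF xt(2) Vx'_eq[OF xt(1)]], assumption)
          (intro has_vector_derivative_add has_vector_derivative_smult mt zt Gt Bt xt)
      with Vxt[OF xt] have e1: "Vxt x t =
          (of_real (m x t) *s ((\<i> * z x t) *s B x t) + mt x t *s \<Gamma> x t)
            + (z x t *s Bt x t + zt x t *s B x t)"
        by (rule vector_derivative_unique_within[OF nbJ[OF xt(2)]])
      have "((\<lambda>y. Vt y t) has_vector_derivative Vxt x t) (at x within I)"
        by (rule mixed_partials_within[OF cv xt nbJ[OF xt(2)] Vx' Vt Vxt])
          (use xt smooth_on_continuous[OF Vxt_smooth] in auto)
      moreover have "((\<lambda>y. Vt y t) has_vector_derivative
          ((\<i> * zx x t) *s ((- \<i> * cnj (z x t)) *s \<Gamma> x t) + (\<i> * zxx x t) *s B x t)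
            + ((z x t * cnj (z x t)) *s V x t + N x t *s \<Gamma> x t)) (at x within I)"
        by (rule has_vector_derivative_transform[OF xt(1) Vt_eq[OF _ xt(2)]], assumption)
          (intro has_vector_derivative_add has_vector_derivative_smult has_vector_derivative_mult_right
            zxx Bx Gx cz xt)
      ultimately have e2: "Vxt x t =
          ((\<i> * zx x t) *s ((- \<i> * cnj (z x t)) *s \<Gamma> x t) + (\<i> * zxx x t) *s B x t)
            + ((z x t * cnj (z x t)) *s V x t + N x t *s \<Gamma> x t)"
        by (rule vector_derivative_unique_within[OF nbI[OF xt(1)]])
      have "mt x t *s \<Gamma> x t + of_real (m x t) *s ((\<i> * z x t) *s B x t)
            + (zt x t *s B x t + z x t *s Bt x t)
          = (\<i> * zxx x t) *s B x t + (\<i> * zx x t) *s ((- \<i> * cnj (z x t)) *s \<Gamma> x t)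
            + (N x t *s \<Gamma> x t + (z x t * cnj (z x t)) *s V x t)"
        using trans[OF e1[symmetric] e2] by (simp only: add.commute)
      from null_frame_zero_curvature[OF fr[OF xt] Bt_B[OF xt] Bt_V[OF xt] this]
      show "zt x t = \<i> * (zxx x t - of_real (m x t) * z x t)"
        "mt x t = zx x t * cnj (z x t) + z x t * cnj (zx x t) + N x t" .
    qed

    show ?thesis
      unfolding yajima_oikawa_def
    proof (intro ballI conjI)
      fix x t assume xt: "x \<in> I" "t \<in> J"
      have "((\<lambda>y. partial_x I z y t) has_vector_derivative zxx x t) (at x within I)"
        by (rule has_vector_derivative_transform[OF xt(1) _ zxx[OF xt]]) (rule px[where f = z, OF _ zx[OF _ xt(2)]])
      then have "partial_x I (partial_x I z) x t = zxx x t"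
        by (rule px[OF xt(1)])
      then show "((\<lambda>s. z x s) has_vector_derivative
          \<i> * (partial_x I (partial_x I z) x t - of_real (m x t) * z x t)) (at t within J)"
        using zt[OF xt] evol(1)[OF xt] by simp
      have "((\<lambda>y. Re (z y t * cnj (z y t))) has_vector_derivative Re (N x t)) (at x within I)"
        by (rule bounded_linear.has_vector_derivative[OF bounded_linear_Re cz[OF xt]])
      then have "partial_x I (\<lambda>y s. (cmod (z y s))\<^sup>2) x t = Re (N x t)"
        by (intro px[OF xt(1)]) (simp add: complex_mult_cnj cmod_power2)
      moreover have "Re (mt x t) = 2 * Re (N x t)"
        by (simp add: evol(2)[OF xt] N_def)
      ultimately show "((\<lambda>s. m x s) has_vector_derivative
          2 * partial_x I (\<lambda>y s. (cmod (z y s))\<^sup>2) x t) (at t within J)"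
        using bounded_linear.has_vector_derivative[OF bounded_linear_Re mt[OF xt]] by simp
    qed
  qed
  show ?thesis
    using vel flow yo by blast
qed

end
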